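(* Fix $m \geq 3$ and a utility vector $\vec{u} = (u_1, \ldots, u_m)$. Then $\mathrm{ADPoA}(r_{plu}, \vec{u}, n)$ is $\Theta(n)$. Specifically, for all $n > 2m$, $$ (u_2-u_m)\left(\frac{n}{m}-2\right) \;\leq\; \mathrm{ADPoA}(r_{plu}, \vec{u}, n) \;\leq\; n u_1 . $$
   Context: Setting. $\mathcal{A}=\{1,\ldots,m\}$ is the set of alternatives and $\mathcal{L}(\mathcal{A})$ the set of strict linear orders over $\mathcal{A}$. There are $n$ agents; a profile is $P=(R_1,\ldots,R_n)\in\mathcal{L}(\mathcal{A})^n$. $\mathrm{top}(R)$ is the top alternative of $R$. The plurality score of $a$ in $P$ is $s_P(a)=|\{j : \mathrm{top}(R_j)=a\}|$. The plurality rule $r=r_{plu}$ returns the alternative $r(P)$ of maximum plurality score, ties broken in favor of the smallest index. Utilities. A utility vector is $\vec u=(u_1,\ldots,u_m)\in\mathbb{R}_{\ge 0}^m$ with $u_1\ge\cdots\ge u_m\ge 0$ and $u_1>u_m$, the same for all agents. $\vec u(R,a)=u_i$ if $a$ is ranked $i$-th in $R$. The social welfare of $a$ in $P$ is $\mathrm{SW}_{\vec u}(P,a)=\sum_{j=1}^n \vec u(R_j,a)$. Iterative plurality voting. Let $P=(R_1,\dots,R_n)$ be the agents' truthful preferences. A process of reported profiles $P^0,P^1,P^2,\ldots$ starts at the truthful profile $P^0=P$. At each round one agent $j$ (chosen by an arbitrary scheduler) changes her reported ranking $R_j^t$ to some $R_j'$, all other reports being unchanged. This is a better response if agent $j$,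 according to her truthful ranking $R_j$, strictly prefers the new outcome $r(R_j',R_{-j}^t)$ to the old outcome $r(R_j^t,R_{-j}^t)$; it is a best response (BR) step if in addition no other report of $j$ at that round yields an outcome she strictly prefers to $r(R_j',R_{-j}^t)$. Every step of a BR sequence starting from the truthful profile changes the winner to the top alternative of the new report, and the moving agent's previously reported top alternative is not the previous winner. A profile $P^*$ in which no agent has a better response is a Nash equilibrium (NE). The set of equilibrium winners is $\mathrm{EW}(P)=\{r(P^* ) : \text{there is a (possibly empty) BR sequence from } P \text{ leading to the NE profile } P^*\}$. Adversarial loss and ADPoA. $\mathrm{D}^+(P)=\mathrm{SW}_{\vec u}(P,r(P))-\min_{a\in\mathrm{EW}(P)}\mathrm{SW}_{\vec u}(P,a)$, and the additive dynamic price of anarchy is $\mathrm{ADPoA}(r_{plu},\vec u,n)=\max_{P\in\mathcal{L}(\mathcal{A})^n}\mathrm{D}^+(P)$. The $\Theta(n)$ is with respect to $n$, with $m$ and $\vec u$ fixed.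
   Formalization: The claim that ADPoA is Θ(n) is stated only for u_2 > u_m; if u_2 = u_m (e.g. u = (1,0,...,0)) the loss is at most u_1 - u_m for every n, so Θ(n) fails. The explicit bounds are unrestricted. *)

theory Defs
  imports Complex_Main "HOL-Library.FuncSet" "HOL-Library.Landau_Symbols"
begin

text \<open>
  Alternatives are \<open>{1..m}\<close>, agents are \<open>{1..n}\<close>. In a ranking \<open>R\<close>,
  \<open>(a, b) \<in> R\<close> means that \<open>a\<close> is strictly preferred to \<open>b\<close>.
\<close>

definition rankings :: "nat \<Rightarrow> nat rel set" where
  "rankings m = {R. R \<subseteq> {1..m} \<times> {1..m} \<and> strict_linear_order_on {1..m} R}"

definition profiles :: "nat \<Rightarrow> nat \<Rightarrow> (nat \<Rightarrow> nat rel) set" where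
  "profiles m n = {1..n} \<rightarrow>\<^sub>E rankings m"

definition top_alt :: "nat \<Rightarrow> nat rel \<Rightarrow> nat" where
  "top_alt m R = (THE a. a \<in> {1..m} \<and> (\<forall>b\<in>{1..m} - {a}. (a, b) \<in> R))"

definition position :: "nat rel \<Rightarrow> nat \<Rightarrow> nat" where
  "position R a = card {b. (b, a) \<in> R} + 1"

definition plurality_score :: "nat \<Rightarrow> nat \<Rightarrow> (nat \<Rightarrow> nat rel) \<Rightarrow> nat \<Rightarrow> nat" where
  "plurality_score m n P a = card {j \<in> {1..n}. top_alt m (P j) = a}"

definition plurality :: "nat \<Rightarrow> nat \<Rightarrow> (nat \<Rightarrow> nat rel) \<Rightarrow> nat" where
  "plurality m n P =
     Min {a \<in> {1..m}. \<forall>b\<in>{1..m}. plurality_score m n P b \<le> plurality_score m n P a}"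

definition utility_vector :: "nat \<Rightarrow> (nat \<Rightarrow> real) \<Rightarrow> bool" where
  "utility_vector m u \<longleftrightarrow>
     (\<forall>i\<in>{1..m}. 0 \<le> u i) \<and> (\<forall>i\<in>{1..m}. \<forall>j\<in>{1..m}. i \<le> j \<longrightarrow> u j \<le> u i) \<and> u m < u 1"

definition social_welfare :: "(nat \<Rightarrow> real) \<Rightarrow> nat \<Rightarrow> (nat \<Rightarrow> nat rel) \<Rightarrow> nat \<Rightarrow> real" where
  "social_welfare u n P a = (\<Sum>j\<in>{1..n}. u (position (P j) a))"

text \<open>Below, \<open>P\<close> is the truthful profile and \<open>Q\<close> the currently reported one.\<close>

definition better_response ::
  "nat \<Rightarrow> nat \<Rightarrow> (nat \<Rightarrow> nat rel) \<Rightarrow> (nat \<Rightarrow> nat rel) \<Rightarrow> nat \<Rightarrow> nat rel \<Rightarrow> bool" where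
  "better_response m n P Q j R' \<longleftrightarrow>
     j \<in> {1..n} \<and> R' \<in> rankings m \<and> (plurality m n (Q(j := R')), plurality m n Q) \<in> P j"

definition best_response ::
  "nat \<Rightarrow> nat \<Rightarrow> (nat \<Rightarrow> nat rel) \<Rightarrow> (nat \<Rightarrow> nat rel) \<Rightarrow> nat \<Rightarrow> nat rel \<Rightarrow> bool" where
  "best_response m n P Q j R' \<longleftrightarrow>
     better_response m n P Q j R' \<and>
     (\<forall>R''\<in>rankings m. (plurality m n (Q(j := R'')), plurality m n (Q(j := R'))) \<notin> P j)"

definition BR_step ::
  "nat \<Rightarrow> nat \<Rightarrow> (nat \<Rightarrow> nat rel) \<Rightarrow> (nat \<Rightarrow> nat rel) \<Rightarrow> (nat \<Rightarrow> nat rel) \<Rightarrow> bool" where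
  "BR_step m n P Q Q' \<longleftrightarrow> (\<exists>j R'. best_response m n P Q j R' \<and> Q' = Q(j := R'))"

definition nash_equilibrium ::
  "nat \<Rightarrow> nat \<Rightarrow> (nat \<Rightarrow> nat rel) \<Rightarrow> (nat \<Rightarrow> nat rel) \<Rightarrow> bool" where
  "nash_equilibrium m n P Q \<longleftrightarrow> (\<nexists>j R'. better_response m n P Q j R')"

definition equilibrium_winners :: "nat \<Rightarrow> nat \<Rightarrow> (nat \<Rightarrow> nat rel) \<Rightarrow> nat set" where
  "equilibrium_winners m n P =
     {plurality m n Q | Q. (BR_step m n P)\<^sup>*\<^sup>* P Q \<and> nash_equilibrium m n P Q}"

text \<open>
  The minimum below is over a nonempty set because every best response sequence
  starting from the truthful profile is finite.
\<close>

definition adversarial_loss :: "nat \<Rightarrow> (nat \<Rightarrow> real) \<Rightarrow> nat \<Rightarrow> (nat \<Rightarrow> nat rel) \<Rightarrow> real" where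
  "adversarial_loss m u n P =
     social_welfare u n P (plurality m n P) -
     Min (social_welfare u n P ` equilibrium_winners m n P)"

definition ADPoA :: "nat \<Rightarrow> (nat \<Rightarrow> real) \<Rightarrow> nat \<Rightarrow> real" where
  "ADPoA m u n = Max (adversarial_loss m u n ` profiles m n)"

end

theory Submission
  imports Defs "HOL-Combinatorics.Transposition"
begin

text \<open>
  The substance of the upper bound is that an equilibrium is reachable at all. Along best responses
  from the truth no voter of the current winner ever wants to move, so each step raises the
  winner in the order given by score and tie-breaking, and the process stops. For the lower bound,
  two alternatives share nearly all first places and are separated by one vote; a single
  manipulation elects the worse one and cannot be answered. This loses about
  \<open>(u 2 - u m) * n / 2\<close>, more than is asked for.
\<close>

section \<open>Rankings\<close>

lemma rankings_irrefl: "R \<in> rankings m \<Longrightarrow> (a, a) \<notin> R"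
  by (auto simp: rankings_def strict_linear_order_on_def irrefl_def)

lemma rankings_trans: "R \<in> rankings m \<Longrightarrow> (a, b) \<in> R \<Longrightarrow> (b, c) \<in> R \<Longrightarrow> (a, c) \<in> R"
  by (auto simp: rankings_def strict_linear_order_on_def dest: transD)

lemma rankings_asym: "R \<in> rankings m \<Longrightarrow> (a, b) \<in> R \<Longrightarrow> (b, a) \<notin> R"
  using rankings_irrefl rankings_trans by metis

lemma rankings_total:
  "R \<in> rankings m \<Longrightarrow> a \<in> {1..m} \<Longrightarrow> b \<in> {1..m} \<Longrightarrow> a \<noteq> b \<Longrightarrow> (a, b) \<in> R \<or> (b, a) \<in> R"
  by (auto simp: rankings_def strict_linear_order_on_def total_on_def)

lemma finite_rankings: "finite (rankings m)"
proof (rule finite_subset)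
  show "rankings m \<subseteq> Pow ({1..m} \<times> {1..m})"
    by (auto simp: rankings_def)
qed simp

text \<open>Needed for two sets: all of \<open>{1..m}\<close>, so that the description in
  \<open>top_alt\<close> denotes something, and the outcomes one agent can enforce, whose favourite
  yields a best response.\<close>

lemma rankings_favourite:
  assumes R: "R \<in> rankings m" and "finite A" "A \<noteq> {}" "A \<subseteq> {1..m}"
  shows "\<exists>a\<in>A. \<forall>b\<in>A - {a}. (a, b) \<in> R"
  using assms(2-)
proof (induction rule: finite_ne_induct)
  case (singleton x)
  then show ?case by simp
next
  case (insert x F)
  then obtain a where a: "a \<in> F" "\<forall>b\<in>F - {a}. (a, b) \<in> R"
    by auto
  have "x \<noteq> a"
    using a insert by auto
  then consider "(x, a) \<in> R" | "(a, x) \<in> R"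
    using rankings_total[OF R, of x a] a insert.prems by blast
  then show ?case
  proof cases
    case 1
    then have "\<forall>b\<in>F. (x, b) \<in> R"
      using a rankings_trans[OF R] by blast
    then show ?thesis
      by auto
  next
    case 2
    then show ?thesis
      using a by blast
  qed
qed

lemma top_alt_eqI:
  assumes R: "R \<in> rankings m" and "a \<in> {1..m}" "\<And>b. b \<in> {1..m} \<Longrightarrow> b \<noteq> a \<Longrightarrow> (a, b) \<in> R"
  shows "top_alt m R = a"
  unfolding top_alt_def
proof (rule the_equality)
  show "a \<in> {1..m} \<and> (\<forall>b\<in>{1..m} - {a}. (a, b) \<in> R)"
    using assms by auto
next
  fix c
  assume "c \<in> {1..m} \<and> (\<forall>b\<in>{1..m} - {c}. (c, b) \<in> R)"
  then show "c = a"
    using assms rankings_asym[OF R] by blast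
qed

lemma top_alt_maximal:
  assumes R: "R \<in> rankings m"
  shows "(d, top_alt m R) \<notin> R"
proof
  assume *: "(d, top_alt m R) \<in> R"
  then have d: "d \<in> {1..m}"
    using R by (auto simp: rankings_def)
  then obtain a where a: "a \<in> {1..m}" "\<forall>b\<in>{1..m} - {a}. (a, b) \<in> R"
    using rankings_favourite[OF R, of "{1..m}"] by auto
  then have "top_alt m R = a"
    using top_alt_eqI[OF R] by auto
  then show False
    using * a d rankings_asym[OF R] rankings_irrefl[OF R] by blast
qed

lemma position_in_range:
  assumes R: "R \<in> rankings m" and a: "a \<in> {1..m}"
  shows "position R a \<in> {1..m}"
proof -
  have "{b. (b, a) \<in> R} \<subseteq> {1..m} - {a}"
    using R rankings_irrefl[OF R] by (auto simp: rankings_def)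
  then have "card {b. (b, a) \<in> R} \<le> card ({1..m} - {a})"
    by (intro card_mono) auto
  then show ?thesis
    using a by (auto simp: position_def)
qed

section \<open>Rankings with prescribed positions\<close>

definition ranking_of :: "nat \<Rightarrow> (nat \<Rightarrow> nat) \<Rightarrow> nat rel" where
  "ranking_of m f = {(a, b). a \<in> {1..m} \<and> b \<in> {1..m} \<and> f a < f b}"

lemma ranking_of_in_rankings:
  assumes "inj_on f {1..m}"
  shows "ranking_of m f \<in> rankings m"
proof -
  have "total_on {1..m} (ranking_of m f)"
    unfolding total_on_def ranking_of_def
    by (simp add: inj_on_eq_iff[OF assms] flip: nat_neq_iff)
  then show ?thesis
    by (auto simp: rankings_def ranking_of_def strict_linear_order_on_def trans_def irrefl_def)
qed

text \<open>\<open>f\<close> maps the alternatives ranked above \<open>a\<close> bijectively onto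
  \<open>{1..<f a}\<close>; surjectivity is what rules out gaps between positions.\<close>

lemma position_ranking_of:
  assumes f: "bij_betw f {1..m} {1..m}" and a: "a \<in> {1..m}"
  shows "position (ranking_of m f) a = f a"
proof -
  have fa: "f a \<in> {1..m}"
    using f a by (rule bij_betw_apply)
  have img: "f ` {1..m} = {1..m}"
    using f by (rule bij_betw_imp_surj_on)
  have "f ` {b. (b, a) \<in> ranking_of m f} = {1..<f a}"
  proof (intro equalityI subsetI)
    fix y assume "y \<in> f ` {b. (b, a) \<in> ranking_of m f}"
    then obtain b where "b \<in> {1..m}" "f b < f a" "y = f b"
      by (auto simp: ranking_of_def)
    then show "y \<in> {1..<f a}"
      using img by force
  next
    fix y assume y: "y \<in> {1..<f a}"
    then have "y \<in> f ` {1..m}"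
      unfolding img using fa by auto
    then show "y \<in> f ` {b. (b, a) \<in> ranking_of m f}"
      using y a by (auto simp: ranking_of_def)
  qed
  moreover have "inj_on f {b. (b, a) \<in> ranking_of m f}"
    by (rule inj_on_subset[OF bij_betw_imp_inj_on[OF f]]) (auto simp: ranking_of_def)
  ultimately have "card {b. (b, a) \<in> ranking_of m f} = card {1..<f a}"
    using card_image by metis
  then show ?thesis
    using fa by (simp add: position_def)
qed

lemma top_alt_ranking_of:
  assumes f: "bij_betw f {1..m} {1..m}" and a: "a \<in> {1..m}" "f a = 1"
  shows "top_alt m (ranking_of m f) = a"
proof (rule top_alt_eqI)
  have inj: "inj_on f {1..m}"
    using f by (simp add: bij_betw_def)
  then show "ranking_of m f \<in> rankings m"
    by (rule ranking_of_in_rankings)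
  fix b assume b: "b \<in> {1..m}" "b \<noteq> a"
  then have "f b \<noteq> 1" "f b \<in> {1..m}"
    using inj_onD[OF inj, of a b] a bij_betwE[OF f] by auto
  then show "(a, b) \<in> ranking_of m f"
    using a b by (auto simp: ranking_of_def)
qed fact

lemma ranking_with_top:
  assumes "d \<in> {1..m}"
  obtains R where "R \<in> rankings m" "top_alt m R = d"
proof -
  have "bij_betw (transpose 1 d) {1..m} {1..m}"
    using assms by (intro bij_betw_transpose_iff) auto
  then show thesis
    using that[of "ranking_of m (transpose 1 d)"] assms
    by (auto simp: top_alt_ranking_of ranking_of_in_rankings bij_betw_def)
qed

section \<open>The plurality rule under unilateral deviations\<close>

text \<open>Lost and gained votes stand on opposite sides to avoid truncated subtraction; this also
  covers a report that keeps its top.\<close>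

lemma score_update:
  assumes "j \<in> {1..n}"
  shows "plurality_score m n (Q(j := R)) c + (if top_alt m (Q j) = c then 1 else 0) =
         plurality_score m n Q c + (if top_alt m R = c then 1 else 0)"
proof -
  define B where "B = {i \<in> {1..n} - {j}. top_alt m (Q i) = c}"
  have B: "finite B" "j \<notin> B"
    by (auto simp: B_def)
  have "{i \<in> {1..n}. top_alt m ((Q(j := R)) i) = c} =
      (if top_alt m R = c then insert j B else B)"
    using assms by (auto simp: B_def)
  moreover have "{i \<in> {1..n}. top_alt m (Q i) = c} =
      (if top_alt m (Q j) = c then insert j B else B)"
    using assms by (auto simp: B_def)
  ultimately show ?thesis
    using B by (simp add: plurality_score_def)
qed

text \<open>Encodes the order by score, ties broken by index, in one number; a vote is worth \<open>Suc m\<close>.\<close>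

definition key :: "nat \<Rightarrow> nat \<Rightarrow> (nat \<Rightarrow> nat rel) \<Rightarrow> nat \<Rightarrow> nat" where
  "key m n Q c = plurality_score m n Q c * Suc m + (m - c)"

lemma key_update:
  assumes "j \<in> {1..n}"
  shows "key m n (Q(j := R)) c + (if top_alt m (Q j) = c then Suc m else 0) =
         key m n Q c + (if top_alt m R = c then Suc m else 0)"
proof -
  have "(plurality_score m n (Q(j := R)) c + (if top_alt m (Q j) = c then 1 else 0)) * Suc m =
        (plurality_score m n Q c + (if top_alt m R = c then 1 else 0)) * Suc m"
    using score_update[OF assms] by simp
  then show ?thesis
    unfolding key_def add_mult_distrib by (auto split: if_splits)
qed

lemma key_bounded: "key m n Q c < Suc n * Suc m"
proof -
  have "plurality_score m n Q c \<le> card {1..n}"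
    unfolding plurality_score_def by (intro card_mono) auto
  then have "plurality_score m n Q c * Suc m \<le> n * Suc m"
    by (intro mult_right_mono) auto
  then show ?thesis
    unfolding key_def mult_Suc by linarith
qed

text \<open>The tie-breaking part is smaller than one vote and survives as the remainder. Keys of
  distinct alternatives in \<open>{1..m}\<close> thus differ even after whole votes are
  added.\<close>

lemma key_mod: "key m n Q c mod Suc m = m - c"
  unfolding key_def mod_mult_self3 by simp

lemma key_inj: "key m n Q a = key m n Q b \<Longrightarrow> a \<in> {1..m} \<Longrightarrow> b \<in> {1..m} \<Longrightarrow> a = b"
  using key_mod[of m n Q a] key_mod[of m n Q b] by auto

text \<open>Turns a non-strict comparison up to one vote into the strict one in which the invariant
  below is phrased.\<close>

lemma key_plus_vote_neq:
  assumes "a \<in> {1..m}" "b \<in> {1..m}"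
  shows "key m n Q a + Suc m \<noteq> key m n Q b"
proof
  assume eq: "key m n Q a + Suc m = key m n Q b"
  then have "m - a = m - b"
    using key_mod[of m n Q a] key_mod[of m n Q b] by (metis mod_add_self2)
  then have "a = b"
    using assms by auto
  then show False
    using eq by simp
qed

text \<open>A lead of one vote outweighs every difference of tie-breaking parts, so keys compare
  lexicographically.\<close>

lemma key_le_iff:
  assumes "a \<in> {1..m}" "b \<in> {1..m}"
  shows "key m n Q a \<le> key m n Q b \<longleftrightarrow>
    plurality_score m n Q a < plurality_score m n Q b \<or>
    plurality_score m n Q a = plurality_score m n Q b \<and> b \<le> a"
proof (cases "plurality_score m n Q a" "plurality_score m n Q b" rule: linorder_cases)
  case less
  then have "Suc (plurality_score m n Q a) * Suc m \<le> plurality_score m n Q b * Suc m"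
    by (intro mult_right_mono) auto
  then show ?thesis
    using less unfolding key_def by auto
next
  case greater
  then have "Suc (plurality_score m n Q b) * Suc m \<le> plurality_score m n Q a * Suc m"
    by (intro mult_right_mono) auto
  moreover have "m - b < Suc m"
    by simp
  ultimately show ?thesis
    using greater unfolding key_def mult_Suc by linarith
next
  case equal
  then show ?thesis
    using assms unfolding key_def by auto
qed

section \<open>The winner as the maximiser of the key\<close>

lemma plurality_eqI:
  assumes w: "w \<in> {1..m}" and max: "\<And>c. c \<in> {1..m} \<Longrightarrow> key m n Q c \<le> key m n Q w"
  shows "plurality m n Q = w"
  unfolding plurality_def
proof (rule Min_eqI)
  show "w \<in> {a \<in> {1..m}. \<forall>b\<in>{1..m}. plurality_score m n Q b \<le> plurality_score m n Q a}"
    using w max by (force simp: key_le_iff)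
  fix y
  assume "y \<in> {a \<in> {1..m}. \<forall>b\<in>{1..m}. plurality_score m n Q b \<le> plurality_score m n Q a}"
  then have "y \<in> {1..m}" "plurality_score m n Q w \<le> plurality_score m n Q y"
    using w by auto
  then show "w \<le> y"
    using max[of y] w by (auto simp: key_le_iff)
qed simp

lemma plurality_props:
  assumes "m \<ge> 1"
  shows plurality_in_range: "plurality m n Q \<in> {1..m}"
    and key_le_plurality: "\<And>c. c \<in> {1..m} \<Longrightarrow> key m n Q c \<le> key m n Q (plurality m n Q)"
proof -
  obtain w where w: "w \<in> {1..m}" "\<forall>c\<in>{1..m}. key m n Q c \<le> key m n Q w"
    using ex_has_greatest_nat[of "\<lambda>c. c \<in> {1..m}" 1 "key m n Q" "Suc n * Suc m"]
      key_bounded assms by (metis atLeastAtMost_iff order_refl)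
  then have "plurality m n Q = w"
    by (intro plurality_eqI) auto
  then show "plurality m n Q \<in> {1..m}"
    "\<And>c. c \<in> {1..m} \<Longrightarrow> key m n Q c \<le> key m n Q (plurality m n Q)"
    using w by auto
qed

lemma key_less_plurality:
  assumes "c \<in> {1..m}" "c \<noteq> plurality m n Q"
  shows "key m n Q c < key m n Q (plurality m n Q)"
proof -
  have "m \<ge> 1"
    using assms by simp
  then show ?thesis
    using key_le_plurality[of m c n Q] key_inj[of m n Q c] plurality_in_range[of m n Q] assms
    by (metis order.order_iff_strict)
qed

section \<open>Convergence of best responses from the truthful profile\<close>

text \<open>
  In the second case \<open>x\<close> is the winner before the last step. Whoever abandons the current winner
  leaves \<open>x\<close> ahead of it, so can only elect alternatives that were already within one vote
  of \<open>x\<close>, and prefers the current report to each of these.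
\<close>

definition BR_invariant ::
  "nat \<Rightarrow> nat \<Rightarrow> (nat \<Rightarrow> nat rel) \<Rightarrow> (nat \<Rightarrow> nat rel) \<Rightarrow> bool" where
  "BR_invariant m n P Q \<longleftrightarrow> Q = P \<or>
     (\<exists>x\<in>{1..m}. x \<noteq> plurality m n Q \<and>
        (\<forall>j\<in>{1..n}. top_alt m (Q j) = top_alt m (P j) \<or>
          (\<forall>d\<in>{1..m}. key m n Q x < key m n Q d + Suc m \<longrightarrow>
             d = top_alt m (Q j) \<or> (top_alt m (Q j), d) \<in> P j)))"

text \<open>A truthful supporter already gets the favourite; for any other supporter the second case
  of the invariant applies. Consequently a step never takes a vote from the current winner.\<close>

lemma winner_voter_no_better_response:
  assumes m: "m \<ge> 1" and P: "P \<in> profiles m n" and inv: "BR_invariant m n P Q"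
    and top: "top_alt m (Q j) = plurality m n Q"
  shows "\<not> better_response m n P Q j R"
proof
  assume "better_response m n P Q j R"
  then have j: "j \<in> {1..n}" and R: "R \<in> rankings m"
    and better: "(plurality m n (Q(j := R)), plurality m n Q) \<in> P j"
    by (auto simp: better_response_def)
  have Pj: "P j \<in> rankings m"
    using P j by (auto simp: profiles_def)
  define w d where "w = plurality m n Q" and "d = plurality m n (Q(j := R))"
  have dw: "(d, w) \<in> P j" "d \<noteq> w"
    using better rankings_irrefl[OF Pj] by (auto simp: w_def d_def)
  have d: "d \<in> {1..m}"
    using plurality_in_range[OF m] by (simp add: d_def)
  have not_truthful: "top_alt m (Q j) \<noteq> top_alt m (P j)"
    using top_alt_maximal[OF Pj, of d] dw top by (auto simp: w_def)
  then obtain x where x: "x \<in> {1..m}" "x \<noteq> w"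
    and pref: "\<forall>d\<in>{1..m}. key m n Q x < key m n Q d + Suc m \<longrightarrow> d = w \<or> (w, d) \<in> P j"
    using inv j top unfolding BR_invariant_def w_def[symmetric] by force
  \<comment> \<open>Leaving \<open>w\<close> cannot hurt \<open>x\<close>, and \<open>d\<close>
    gains at most one vote, so \<open>d\<close> was already within one vote of
    \<open>x\<close>.\<close>
  have "key m n (Q(j := R)) x \<le> key m n (Q(j := R)) d"
    using key_le_plurality[OF m x(1)] by (simp add: d_def)
  moreover have "key m n Q x \<le> key m n (Q(j := R)) x"
    using key_update[OF j, of m Q R x] x top by (auto simp: w_def split: if_splits)
  moreover have "key m n (Q(j := R)) d \<le> key m n Q d + Suc m"
    using key_update[OF j, of m Q R d] by (auto split: if_splits)
  ultimately have "key m n Q x < key m n Q d + Suc m"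
    using key_plus_vote_neq[OF d x(1), of n Q] by linarith
  then show False
    using pref d dw rankings_asym[OF Pj] by blast
qed

text \<open>The old winner takes over the role of \<open>x\<close>. The key of the winner is the
  potential that makes the process stop.\<close>

lemma BR_step_invariant:
  assumes m: "m \<ge> 1" and P: "P \<in> profiles m n" and inv: "BR_invariant m n P Q"
    and step: "BR_step m n P Q Q'"
  shows "BR_invariant m n P Q' \<and>
    key m n Q (plurality m n Q) < key m n Q' (plurality m n Q')"
proof -
  obtain j R where best: "best_response m n P Q j R" and Q': "Q' = Q(j := R)"
    using step by (auto simp: BR_step_def)
  then have br: "better_response m n P Q j R"
    by (simp add: best_response_def)
  then have j: "j \<in> {1..n}" and R: "R \<in> rankings m"
    and better: "(plurality m n Q', plurality m n Q) \<in> P j"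
    by (auto simp: better_response_def Q')
  have Pj: "P j \<in> rankings m"
    using P j by (auto simp: profiles_def)
  define w b a where "w = plurality m n Q" and "b = plurality m n Q'" and "a = top_alt m (Q j)"
  have bw: "(b, w) \<in> P j" "b \<noteq> w"
    using better rankings_irrefl[OF Pj] by (auto simp: w_def b_def)
  have aw: "a \<noteq> w"
    using winner_voter_no_better_response[OF m P inv] br by (auto simp: a_def w_def)
  have b: "b \<in> {1..m}" and w: "w \<in> {1..m}"
    using plurality_in_range[OF m] by (auto simp: b_def w_def)
  have upd: "key m n Q' c + (if a = c then Suc m else 0) =
      key m n Q c + (if top_alt m R = c then Suc m else 0)" for c
    using key_update[OF j, of m Q R c] by (simp add: Q' a_def)
  have less1: "key m n Q c < key m n Q w" if "c \<in> {1..m}" "c \<noteq> w" for c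
    using key_less_plurality that by (simp add: w_def)
  have less2: "key m n Q' c < key m n Q' b" if "c \<in> {1..m}" "c \<noteq> b" for c
    using key_less_plurality that by (simp add: b_def)
  have w_ge: "key m n Q w \<le> key m n Q' w"
    using upd[of w] aw by (auto split: if_splits)
  \<comment> \<open>A vote for the new winner is not demanded by \<open>best_response\<close> but
    forced: without it \<open>b\<close> cannot rise, while \<open>w\<close> loses nothing.\<close>
  have top_R: "top_alt m R = b"
  proof (rule ccontr)
    assume "top_alt m R \<noteq> b"
    then have "key m n Q' b \<le> key m n Q b"
      using upd[of b] by (auto split: if_splits)
    then show False
      using less1[OF b bw(2)] less2[OF w] bw w_ge by force
  qed
  have w_same: "key m n Q' w = key m n Q w"
    using upd[of w] aw top_R bw by auto
  have up: "key m n Q w < key m n Q' b"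
    using less2[OF w] bw w_same by auto
  \<comment> \<open>If \<open>a = b\<close>, the key of \<open>b\<close> would stay below that of
    \<open>w\<close>; so \<open>b\<close> gains a full vote.\<close>
  have b_up: "key m n Q' b = key m n Q b + Suc m"
    using upd[of b] top_R less1[OF b bw(2)] up by (auto split: if_splits)
  have others: "key m n Q' c \<le> key m n Q c" if "c \<noteq> b" for c
    using upd[of c] that top_R by (auto split: if_splits)
  \<comment> \<open>Only here is optimality of the response used: any other \<open>d\<close> still
    within one vote of \<open>w\<close> could have been elected by voting for it instead.\<close>
  have mover: "\<forall>d\<in>{1..m}. key m n Q' w < key m n Q' d + Suc m \<longrightarrow>
          d = top_alt m (Q' j) \<or> (top_alt m (Q' j), d) \<in> P j"
  proof (intro ballI impI)
    fix d assume d: "d \<in> {1..m}" and near: "key m n Q' w < key m n Q' d + Suc m"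
    consider "d = b" | "d = w" | "d \<noteq> b" "d \<noteq> w"
      by blast
    then have "d = b \<or> (b, d) \<in> P j"
    proof cases
      case 3
      \<comment> \<open>Had the mover abandoned \<open>d\<close>, one more vote would merely restore
        its old key, which is below that of \<open>w\<close>.\<close>
      have "d \<noteq> a"
        using upd[of d] near w_same less1[OF d 3(2)] top_R 3 by auto
      have "key m n Q w < key m n Q d + Suc m"
        using near w_same others[OF 3(1)] by linarith
      obtain S where S: "S \<in> rankings m" "top_alt m S = d"
        using ranking_with_top d by blast
      have upd_S: "key m n (Q(j := S)) c + (if a = c then Suc m else 0) =
          key m n Q c + (if d = c then Suc m else 0)" for c
        using key_update[OF j, of m Q S c] S by (simp add: a_def)
      have "key m n (Q(j := S)) c \<le> key m n (Q(j := S)) d" if c: "c \<in> {1..m}" for c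
      proof (cases "c = d")
        case False
        then have "key m n (Q(j := S)) c \<le> key m n Q w"
          using upd_S[of c] key_le_plurality[OF m c, of n Q] unfolding w_def[symmetric]
          by (auto split: if_splits)
        moreover have "key m n (Q(j := S)) d = key m n Q d + Suc m"
          using upd_S[of d] \<open>d \<noteq> a\<close> by auto
        ultimately show ?thesis
          using \<open>key m n Q w < key m n Q d + Suc m\<close> by linarith
      qed simp
      then have "plurality m n (Q(j := S)) = d"
        using d by (intro plurality_eqI) auto
      then have "(d, b) \<notin> P j"
        using best S(1) unfolding best_response_def b_def Q' by metis
      then show ?thesis
        using rankings_total[OF Pj d b] by blast
    qed (use bw in auto)
    then show "d = top_alt m (Q' j) \<or> (top_alt m (Q' j), d) \<in> P j"
      using top_R by (simp add: Q')
  qed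
  have "top_alt m (Q' i) = top_alt m (P i) \<or>
      (\<forall>d\<in>{1..m}. key m n Q' w < key m n Q' d + Suc m \<longrightarrow>
         d = top_alt m (Q' i) \<or> (top_alt m (Q' i), d) \<in> P i)" if i: "i \<in> {1..n}" for i
  proof -
    consider "i = j" | "i \<noteq> j" "Q = P" | "i \<noteq> j" "Q \<noteq> P"
      by blast
    then show ?thesis
    proof cases
      case 1
      then show ?thesis
        using mover by blast
    next
      case 2
      then show ?thesis
        by (simp add: Q')
    next
      case 3
      then obtain x where x: "x \<in> {1..m}" "x \<noteq> w"
        and pref: "top_alt m (Q i) = top_alt m (P i) \<or>
          (\<forall>d\<in>{1..m}. key m n Q x < key m n Q d + Suc m \<longrightarrow>
             d = top_alt m (Q i) \<or> (top_alt m (Q i), d) \<in> P i)"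
        using inv i unfolding BR_invariant_def w_def[symmetric] by blast
      \<comment> \<open>No new alternatives need checking: those other than \<open>b\<close> gain
        nothing while the threshold rises from \<open>x\<close> to \<open>w\<close>, and
        \<open>b\<close> was within one vote of \<open>w\<close>, hence of \<open>x\<close>.\<close>
      have "key m n Q x < key m n Q d + Suc m" if "key m n Q' w < key m n Q' d + Suc m" for d
        using that others[of d] b_up up w_same less1[OF x] by (cases "d = b") auto
      then show ?thesis
        using pref 3 by (auto simp: Q')
    qed
  qed
  then have "\<forall>i\<in>{1..n}. top_alt m (Q' i) = top_alt m (P i) \<or>
      (\<forall>d\<in>{1..m}. key m n Q' w < key m n Q' d + Suc m \<longrightarrow>
         d = top_alt m (Q' i) \<or> (top_alt m (Q' i), d) \<in> P i)"
    by (rule ballI)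
  then have "BR_invariant m n P Q'"
    unfolding BR_invariant_def b_def[symmetric]
    using w not_sym[OF bw(2)] by (intro disjI2 bexI[of _ w] conjI)
  then show ?thesis
    using up by (simp add: w_def b_def)
qed

text \<open>The favourite among the outcomes the agent can enforce is at least as good as the
  outcome of \<open>R\<close>, hence also better than the current winner.\<close>

lemma BR_step_exists:
  assumes m: "m \<ge> 1" and P: "P \<in> profiles m n" and "\<not> nash_equilibrium m n P Q"
  shows "\<exists>Q'. BR_step m n P Q Q'"
proof -
  obtain j R where br: "better_response m n P Q j R"
    using assms by (auto simp: nash_equilibrium_def)
  then have j: "j \<in> {1..n}" and R: "R \<in> rankings m"
    by (auto simp: better_response_def)
  have Pj: "P j \<in> rankings m"
    using P j by (auto simp: profiles_def)
  let ?A = "(\<lambda>S. plurality m n (Q(j := S))) ` rankings m"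
  have "\<exists>a\<in>?A. \<forall>b\<in>?A - {a}. (a, b) \<in> P j"
    using R plurality_in_range[OF m]
    by (intro rankings_favourite[OF Pj]) (auto simp: finite_rankings)
  then obtain S where S: "S \<in> rankings m"
    and max: "\<And>T. T \<in> rankings m \<Longrightarrow> plurality m n (Q(j := T)) = plurality m n (Q(j := S)) \<or>
      (plurality m n (Q(j := S)), plurality m n (Q(j := T))) \<in> P j"
    by blast
  have "better_response m n P Q j S"
    using br max[OF R] S rankings_trans[OF Pj] unfolding better_response_def by metis
  moreover have "(plurality m n (Q(j := T)), plurality m n (Q(j := S))) \<notin> P j"
    if "T \<in> rankings m" for T
    using max[OF that] rankings_asym[OF Pj] rankings_irrefl[OF Pj] by metis
  ultimately show ?thesis
    by (auto simp: BR_step_def best_response_def)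
qed

text \<open>A reachable profile whose winner has the largest key admits no further step. This
  ensures that \<open>Min\<close> in \<open>adversarial_loss\<close> is not taken over the empty
  set.\<close>

lemma equilibrium_winners_nonempty:
  assumes m: "m \<ge> 1" and P: "P \<in> profiles m n"
  shows "equilibrium_winners m n P \<noteq> {}"
proof -
  let ?reach = "\<lambda>Q. (BR_step m n P)\<^sup>*\<^sup>* P Q"
  have inv: "BR_invariant m n P Q" if "?reach Q" for Q
    using that
  proof induction
    case base
    then show ?case by (simp add: BR_invariant_def)
  next
    case (step Q Q')
    then show ?case using BR_step_invariant[OF m P] by blast
  qed
  obtain Q where Q: "?reach Q"
    and max: "\<And>Q'. ?reach Q' \<Longrightarrow>
      key m n Q' (plurality m n Q') \<le> key m n Q (plurality m n Q)"
    using ex_has_greatest_nat[of ?reach P "\<lambda>Q. key m n Q (plurality m n Q)" "Suc n * Suc m"]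
      key_bounded by blast
  have "nash_equilibrium m n P Q"
  proof (rule ccontr)
    assume "\<not> nash_equilibrium m n P Q"
    then obtain Q' where "BR_step m n P Q Q'"
      using BR_step_exists[OF m P] by blast
    then show False
      using BR_step_invariant[OF m P inv[OF Q]] max[of Q'] Q
      by (meson linorder_not_less rtranclp.rtrancl_into_rtrancl)
  qed
  then show ?thesis
    using Q by (auto simp: equilibrium_winners_def)
qed

section \<open>The upper bound\<close>

lemma equilibrium_winners_in_range:
  "m \<ge> 1 \<Longrightarrow> equilibrium_winners m n P \<subseteq> {1..m}"
  using plurality_in_range by (force simp: equilibrium_winners_def)

lemma finite_equilibrium_winners: "m \<ge> 1 \<Longrightarrow> finite (equilibrium_winners m n P)"
  using equilibrium_winners_in_range by (rule finite_subset) auto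

lemma social_welfare_bounds:
  assumes u: "utility_vector m u" and P: "P \<in> profiles m n" and a: "a \<in> {1..m}"
  shows "0 \<le> social_welfare u n P a" "social_welfare u n P a \<le> real n * u 1"
proof -
  have "0 \<le> u (position (P j) a) \<and> u (position (P j) a) \<le> u 1" if "j \<in> {1..n}" for j
  proof -
    have "P j \<in> rankings m"
      using P that by (auto simp: profiles_def)
    then have "position (P j) a \<in> {1..m}"
      using position_in_range a by blast
    then show ?thesis
      using u a by (auto simp: utility_vector_def)
  qed
  then show "0 \<le> social_welfare u n P a" "social_welfare u n P a \<le> real n * u 1"
    using sum_bounded_above[of "{1..n}" "\<lambda>j. u (position (P j) a)" "u 1"]
    by (auto simp: social_welfare_def intro!: sum_nonneg)
qed

lemma adversarial_loss_le:
  assumes m: "m \<ge> 1" and u: "utility_vector m u" and P: "P \<in> profiles m n"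
  shows "adversarial_loss m u n P \<le> real n * u 1"
proof -
  have "0 \<le> Min (social_welfare u n P ` equilibrium_winners m n P)"
  proof (rule Min.boundedI)
    fix x assume "x \<in> social_welfare u n P ` equilibrium_winners m n P"
    then show "0 \<le> x"
      using equilibrium_winners_in_range[OF m] social_welfare_bounds(1)[OF u P] by blast
  qed (use finite_equilibrium_winners[OF m] equilibrium_winners_nonempty[OF m P] in auto)
  then show ?thesis
    using social_welfare_bounds(2)[OF u P plurality_in_range[OF m], of n P]
    unfolding adversarial_loss_def by linarith
qed

lemma finite_profiles: "finite (profiles m n)"
  by (simp add: profiles_def finite_PiE finite_rankings)

lemma ADPoA_ge:
  assumes "P \<in> profiles m n"
  shows "adversarial_loss m u n P \<le> ADPoA m u n"
  using assms finite_profiles by (auto simp: ADPoA_def)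

lemma ADPoA_le:
  assumes m: "m \<ge> 1" and u: "utility_vector m u"
  shows "ADPoA m u n \<le> real n * u 1"
proof -
  obtain R where "R \<in> rankings m"
    using ranking_with_top[of 1 m] m by auto
  then have "profiles m n \<noteq> {}"
    by (auto simp: profiles_def PiE_eq_empty_iff)
  then show ?thesis
    using adversarial_loss_le[OF m u] finite_profiles by (auto simp: ADPoA_def)
qed

section \<open>The lower bound\<close>

lemma plurality_neqI:
  assumes "b \<in> {1..m}" "c \<in> {1..m}"
    and "plurality_score m n Q c < plurality_score m n Q b \<or>
      plurality_score m n Q c = plurality_score m n Q b \<and> b < c"
  shows "plurality m n Q \<noteq> c"
proof -
  have "\<not> key m n Q b \<le> key m n Q c"
    using assms by (auto simp: key_le_iff)
  then show ?thesis
    using key_le_plurality[of m b n Q] assms(1) by auto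
qed

lemma bij_betw_selfI: "finite A \<Longrightarrow> f ` A \<subseteq> A \<Longrightarrow> inj_on f A \<Longrightarrow> bij_betw f A A"
  by (simp add: bij_betw_def endo_inj_surj)

text \<open>
  The agents rank \<open>1, 2, \<dots>, m\<close> (\<open>h\<close> agents), \<open>2, 3, \<dots>, m, 1\<close>
  (\<open>h + 1\<close> agents) or \<open>3, 1, 4, \<dots>, m, 2\<close> (\<open>k\<close> agents). Alternative 2 wins by one vote.
  One agent of the last kind voting for 1 makes 1 win the tie, and nobody can answer, since every
  supporter of 2 already votes for it. The agents of the first two kinds nearly cancel
  in pairs worth \<open>u 2 - u m\<close> each.
\<close>

lemma ADPoA_ge_construction:
  assumes m: "m \<ge> 3" and u: "utility_vector m u"
    and n: "n = 2 * h + 1 + k" and k: "k \<in> {1, 2}" and h: "h \<ge> 2"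
  shows "(real h + 1 - real k) * (u 2 - u m) \<le> ADPoA m u n"
proof -
  \<comment> \<open>Positions in \<open>2, 3, ..., m, 1\<close> and
    \<open>3, 1, 4, ..., m, 2\<close>; the default \<open>a - 1\<close> closes the gap left by the
    alternative sent to last place.\<close>
  define f2 :: "nat \<Rightarrow> nat" where "f2 a = (if a = 1 then m else a - 1)" for a
  define f3 :: "nat \<Rightarrow> nat" where
    "f3 a = (if a = 3 then 1 else if a = 1 then 2 else if a = 2 then m else a - 1)" for a
  have bij1: "bij_betw id {1..m} {1..m}"
    by simp
  have bij2: "bij_betw f2 {1..m} {1..m}"
    using m by (intro bij_betw_selfI) (auto simp: f2_def inj_on_def)
  have bij3: "bij_betw f3 {1..m} {1..m}"
    using m by (intro bij_betw_selfI) (auto simp: f3_def inj_on_def split: if_splits)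
  define R1 R2 R3 where "R1 = ranking_of m id" and "R2 = ranking_of m f2"
    and "R3 = ranking_of m f3"
  have R: "R1 \<in> rankings m" "R2 \<in> rankings m" "R3 \<in> rankings m"
    using bij1 bij2 bij3 by (auto simp: R1_def R2_def R3_def bij_betw_def intro: ranking_of_in_rankings)
  have tops: "top_alt m R1 = 1" "top_alt m R2 = 2" "top_alt m R3 = 3"
    unfolding R1_def R2_def R3_def using m
    by (auto intro!: top_alt_ranking_of[OF bij1] top_alt_ranking_of[OF bij2]
        top_alt_ranking_of[OF bij3] simp: f2_def f3_def)
  have pos: "position R1 1 = 1" "position R1 2 = 2" "position R2 1 = m" "position R2 2 = 1"
    "position R3 1 = 2" "position R3 2 = m"
    unfolding R1_def R2_def R3_def using m
    by (simp_all add: position_ranking_of[OF bij1] position_ranking_of[OF bij2]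
        position_ranking_of[OF bij3]) (simp_all add: f2_def f3_def)
  \<comment> \<open>Blocks of sizes \<open>h\<close>, \<open>h + 1\<close> and \<open>k\<close>; as
    \<open>k\<close> is positive, agent \<open>n\<close> lies in the last and serves as
    manipulator.\<close>
  define P where "P = (\<lambda>j\<in>{1..n}. if j \<le> h then R1 else if j \<le> 2 * h + 1 then R2 else R3)"
  have P: "P \<in> profiles m n"
    using R by (auto simp: P_def profiles_def)
  have P_cases: "P j = R1 \<or> P j = R2 \<or> P j = R3" if "j \<in> {1..n}" for j
    using that by (auto simp: P_def)
  have n_in: "n \<in> {1..n}" and Pn: "P n = R3"
    using n k by (auto simp: P_def)
  have "{j \<in> {1..n}. top_alt m (P j) = 1} = {1..h}"
    using n tops by (auto simp: P_def split: if_splits)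
  then have score1: "plurality_score m n P 1 = h"
    by (simp add: plurality_score_def)
  have "{j \<in> {1..n}. top_alt m (P j) = 2} = {h + 1..2 * h + 1}"
    using n tops by (auto simp: P_def split: if_splits)
  then have score2: "plurality_score m n P 2 = h + 1"
    by (simp add: plurality_score_def)
  have score_other: "plurality_score m n P c \<le> k" if "c \<noteq> 1" "c \<noteq> 2" for c
  proof -
    have "{j \<in> {1..n}. top_alt m (P j) = c} \<subseteq> {2 * h + 2..n}"
      using n tops that by (auto simp: P_def split: if_splits)
    then have "card {j \<in> {1..n}. top_alt m (P j) = c} \<le> card {2 * h + 2..n}"
      by (intro card_mono) auto
    then show ?thesis
      using n by (simp add: plurality_score_def)
  qed
  have k2: "k < h + 1"
    using k h by auto
  have in_range: "1 \<in> {1..m}" "2 \<in> {1..m}"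
    using m by auto
  have win_P: "plurality m n P = 2"
  proof (rule plurality_eqI[OF in_range(2)])
    fix c assume c: "c \<in> {1..m}"
    show "key m n P c \<le> key m n P 2"
      unfolding key_le_iff[OF c in_range(2)]
      using score1 score2 score_other[of c] k2 by (cases "c = 1 \<or> c = 2") auto
  qed
  define Q where "Q = P(n := R1)"
  have upd: "plurality_score m n Q c + (if c = 3 then 1 else 0) =
      plurality_score m n P c + (if c = 1 then 1 else 0)" for c
    using score_update[OF n_in, of m P R1 c] tops Pn by (auto simp: Q_def)
  have Q1: "plurality_score m n Q 1 = h + 1" and Q2: "plurality_score m n Q 2 = h + 1"
    using upd[of 1] upd[of 2] score1 score2 by auto
  \<comment> \<open>Strict, so that one further vote still leaves at most \<open>k\<close>, which is
    below \<open>h + 1\<close>.\<close>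
  have Q_other: "plurality_score m n Q c < k" if "c \<noteq> 1" "c \<noteq> 2" for c
  proof (cases "c = 3")
    case True
    then show ?thesis
      using upd[of c] score_other[OF that] by auto
  next
    case False
    then have "{j \<in> {1..n}. top_alt m (P j) = c} = {}"
      using that tops P_cases by fastforce
    then have "plurality_score m n P c = 0"
      unfolding plurality_score_def by (metis card.empty)
    then show ?thesis
      using upd[of c] that False k by auto
  qed
  have win_Q: "plurality m n Q = 1"
  proof (rule plurality_eqI[OF in_range(1)])
    fix c assume c: "c \<in> {1..m}"
    show "key m n Q c \<le> key m n Q 1"
      unfolding key_le_iff[OF c in_range(1)]
      using Q1 Q2 Q_other[of c] k2 by (cases "c = 1 \<or> c = 2") auto
  qed
  \<comment> \<open>Agent \<open>n\<close> ranks only 3 above 1 and already votes for 3 in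
    \<open>P\<close>, so no report lifts 3 above \<open>k\<close> votes, against
    \<open>h + 1\<close> for 2.\<close>
  have "(plurality m n (P(n := S)), 1) \<notin> R3" for S
  proof
    assume *: "(plurality m n (P(n := S)), 1) \<in> R3"
    then have three: "plurality m n (P(n := S)) = 3"
      using m by (auto simp: R3_def ranking_of_def f3_def split: if_splits)
    have "plurality_score m n (P(n := S)) 3 \<le> k" "h + 1 \<le> plurality_score m n (P(n := S)) 2"
      using score_update[OF n_in, of m P S 3] score_update[OF n_in, of m P S 2]
        score_other[of 3] score2 tops Pn by (auto split: if_splits)
    then show False
      using plurality_neqI[of 2 m 3 n "P(n := S)"] three k2 m by auto
  qed
  moreover have "(1, 2) \<in> R3"
    using m by (auto simp: R3_def ranking_of_def f3_def)
  ultimately have "best_response m n P P n R1"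
    using R n_in win_P win_Q Pn
    by (simp add: best_response_def better_response_def Q_def)
  then have "BR_step m n P P Q"
    by (auto simp: BR_step_def Q_def)
  moreover have "nash_equilibrium m n P Q"
    unfolding nash_equilibrium_def
  proof safe
    fix j S assume "better_response m n P Q j S"
    then have j: "j \<in> {1..n}" and better: "(plurality m n (Q(j := S)), 1) \<in> P j"
      by (auto simp: better_response_def win_Q)
    define d where "d = plurality m n (Q(j := S))"
    have Pj: "P j \<in> rankings m"
      using P j by (auto simp: profiles_def)
    have d: "d \<in> {1..m}" "d \<noteq> 1"
      using better Pj rankings_irrefl[OF Pj] by (auto simp: d_def rankings_def)
    note upd' = score_update[OF j, of m Q S]
    have "d = 2"
    proof (rule ccontr)
      assume "d \<noteq> 2"
      then have "plurality_score m n (Q(j := S)) d \<le> k"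
        using upd'[of d] Q_other[of d] d by (auto split: if_splits)
      \<comment> \<open>A single report can withdraw a vote from 1 or from 2, but not from
        both.\<close>
      moreover have "h + 1 \<le> plurality_score m n (Q(j := S)) 1 \<or>
          h + 1 \<le> plurality_score m n (Q(j := S)) 2"
        using upd'[of 1] upd'[of 2] Q1 Q2 by (auto split: if_splits)
      ultimately show False
        using plurality_neqI[OF in_range(1) d(1), of n "Q(j := S)"]
          plurality_neqI[OF in_range(2) d(1), of n "Q(j := S)"] k2 d_def by linarith
    qed
    then have "(2, 1) \<in> P j"
      using better by (simp add: d_def)
    moreover have "(2, 1) \<notin> R1" "(2, 1) \<notin> R3"
      using m by (auto simp: R1_def R3_def ranking_of_def f3_def)
    ultimately have "P j = R2"
      using P_cases[OF j] by auto
    \<comment> \<open>Agent \<open>j\<close> is not the manipulator \<open>n\<close>, because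
      \<open>R2\<close> and \<open>R3\<close> have different tops.\<close>
    then have "Q j = R2"
      using Pn tops by (auto simp: Q_def)
    then have "plurality_score m n (Q(j := S)) 2 \<le> h + 1"
      "h + 1 \<le> plurality_score m n (Q(j := S)) 1"
      using upd'[of 1] upd'[of 2] Q1 Q2 tops by (auto split: if_splits)
    then show False
      using plurality_neqI[OF in_range, of n "Q(j := S)"] \<open>d = 2\<close> d_def by linarith
  qed
  ultimately have "1 \<in> equilibrium_winners m n P"
    using win_Q unfolding equilibrium_winners_def by (intro CollectI exI[of _ Q]) auto
  then have "Min (social_welfare u n P ` equilibrium_winners m n P) \<le> social_welfare u n P 1"
    using finite_equilibrium_winners[of m n P] m by (intro Min_le) auto
  moreover have "social_welfare u n P 2 - social_welfare u n P 1 =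
      real h * (u 2 - u 1) + real (h + 1) * (u 1 - u m) + real k * (u m - u 2)"
  proof -
    let ?g = "\<lambda>j. u (position (P j) 2) - u (position (P j) 1)"
    have split: "{1..n} = {1..h} \<union> ({h + 1..2 * h + 1} \<union> {2 * h + 2..n})"
      using n by auto
    have "social_welfare u n P 2 - social_welfare u n P 1 = sum ?g {1..n}"
      by (simp add: social_welfare_def sum_subtractf)
    also have "\<dots> = sum ?g {1..h} + (sum ?g {h + 1..2 * h + 1} + sum ?g {2 * h + 2..n})"
      unfolding split by (simp add: sum.union_disjoint Int_Un_distrib)
    also have "sum ?g {1..h} = real h * (u 2 - u 1)"
      using n pos by (simp add: P_def)
    also have "sum ?g {h + 1..2 * h + 1} = real (h + 1) * (u 1 - u m)"
      using n pos by (simp add: P_def)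
    also have "sum ?g {2 * h + 2..n} = real k * (u m - u 2)"
      using n pos by (simp add: P_def)
    finally show ?thesis
      by simp
  qed
  \<comment> \<open>The welfare difference equals
    \<open>(h + 1 - k) * (u 2 - u m) + (u 1 - u 2)\<close>, and the last summand is dropped.\<close>
  moreover have "u 2 \<le> u 1"
    using u m by (auto simp: utility_vector_def)
  ultimately have "(real h + 1 - real k) * (u 2 - u m) \<le> adversarial_loss m u n P"
    unfolding adversarial_loss_def win_P by (simp add: algebra_simps)
  then show ?thesis
    using ADPoA_ge[OF P, of u] by linarith
qed

lemma ADPoA_lower_bound:
  assumes m: "m \<ge> 3" and u: "utility_vector m u" and n: "n > 2 * m"
  shows "(u 2 - u m) * (real n / real m - 2) \<le> ADPoA m u n"
proof -
  \<comment> \<open>\<open>k\<close> absorbs the parity of \<open>n\<close>: it is 1 for even and 2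
    for odd \<open>n\<close>. Since \<open>n > 6\<close>, \<open>h\<close> is at least 2.\<close>
  define h where "h = (n - 2) div 2"
  define k where "k = n - 2 * h - 1"
  have hk: "n = 2 * h + 1 + k" "k \<in> {1, 2}" "h \<ge> 2"
    using m n unfolding h_def k_def by auto
  have "real n / real m \<le> real n / 3"
    using m by (intro divide_left_mono) auto
  moreover have "real n = 2 * real h + 1 + real k" "real k \<le> 2" "real h \<ge> 2"
    using hk by auto
  \<comment> \<open>With \<open>n / m\<close> replaced by \<open>n / 3\<close>, this amounts to
    \<open>4 * k <= h + 8\<close>.\<close>
  ultimately have "real n / real m - 2 \<le> real h + 1 - real k"
    by linarith
  moreover have "u m \<le> u 2"
    using u m by (auto simp: utility_vector_def)
  ultimately have "(u 2 - u m) * (real n / real m - 2) \<le> (real h + 1 - real k) * (u 2 - u m)"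
    by (subst mult.commute, intro mult_right_mono) auto
  also have "\<dots> \<le> ADPoA m u n"
    using ADPoA_ge_construction[OF m u] hk by blast
  finally show ?thesis .
qed

section \<open>Linear growth from the two bounds\<close>

theorem theorem1:
  fixes m :: nat and u :: "nat \<Rightarrow> real"
  assumes "m \<ge> 3" and "utility_vector m u"
  shows "(u 2 > u m \<longrightarrow> (\<lambda>n. ADPoA m u n) \<in> \<Theta>(\<lambda>n. real n)) \<and>
    (\<forall>n > 2 * m. (u 2 - u m) * (real n / real m - 2) \<le> ADPoA m u n \<and>
                 ADPoA m u n \<le> real n * u 1)"
proof -
  have bounds: "(u 2 - u m) * (real n / real m - 2) \<le> ADPoA m u n"
    "ADPoA m u n \<le> real n * u 1" if "n > 2 * m" for n
    using ADPoA_lower_bound[OF assms that] ADPoA_le[OF _ assms(2), of n] assms(1) by simp_all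
  have "(\<lambda>n. ADPoA m u n) \<in> \<Theta>(\<lambda>n. real n)" if um: "u 2 > u m"
  proof (rule bigthetaI')
    show "0 < (u 2 - u m) / (2 * real m)"
      using um assms(1) by simp
    have "m \<in> {1..m}"
      using assms(1) by simp
    then have "0 \<le> u m" "u m < u 1"
      using assms(2) unfolding utility_vector_def by blast+
    then show "0 < u 1"
      by linarith
    show "\<forall>\<^sub>F n in sequentially. (u 2 - u m) / (2 * real m) * norm (real n) \<le> norm (ADPoA m u n) \<and>
        norm (ADPoA m u n) \<le> u 1 * norm (real n)"
      \<comment> \<open>From \<open>4 * m\<close> on, the subtracted 2 is at most half of
        \<open>n / m\<close>; hence the factor 2 in the lower constant.\<close>
      using eventually_ge_at_top[of "4 * m"]
    proof eventually_elim
      case (elim n)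
      have "n > 2 * m"
        using elim assms(1) by linarith
      have "real n / (2 * real m) \<le> real n / real m - 2"
      proof -
        have "4 * real m \<le> real n" "real m > 0"
          using elim assms(1) by linarith+
        then show ?thesis
          by (simp add: field_simps)
      qed
      then have "(u 2 - u m) * (real n / (2 * real m)) \<le> (u 2 - u m) * (real n / real m - 2)"
        using um by (intro mult_left_mono) auto
      also have "\<dots> \<le> ADPoA m u n"
        using bounds(1) \<open>n > 2 * m\<close> .
      finally have lower: "(u 2 - u m) / (2 * real m) * real n \<le> ADPoA m u n"
        by simp
      moreover have "0 \<le> (u 2 - u m) / (2 * real m) * real n"
        using um by simp
      ultimately show ?case
        using bounds(2)[OF \<open>n > 2 * m\<close>] unfolding mult.commute[of "u 1"] by simp
    qed
  qed
  then show ?thesis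
    using bounds by blast
qed

end
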